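(* Let $n\ge 1$ and $k\ge 1$ be integers, and let $\mathcal{C}_{n,k}^*=\{M\in\mathcal{C}_n^* : \mathrm{cpr}\,M=k\}$. Then the interior of $\mathcal{C}_{n,k}^*$ in the space of real symmetric $n\times n$ matrices is nonempty if and only if $n\le k\le p_n$.
   Context: An $n\times n$ matrix $M$ is completely positive if $M=VV^\top$ for some entrywise nonnegative, not necessarily square, matrix $V$. $\mathcal{C}_n^*$ denotes the cone of completely positive $n\times n$ matrices. The cp-rank $\mathrm{cpr}\,M$ of a nonzero completely positive matrix $M$ is the minimum number of columns of an entrywise nonnegative $V$ with $M=VV^\top$; $\mathrm{cpr}\,0=0$, and $\mathrm{cpr}\,M=\infty$ if $M$ is not completely positive. $p_n=\max\{\mathrm{cpr}\,M : M\in\mathcal{C}_n^*\}$. *)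

theory Defs
  imports "HOL-Analysis.Analysis" "HOL-Library.Extended_Nat"
begin

text \<open>
  \<open>nonneg_factor M m V\<close> says that \<open>V\<close> is an entrywise nonnegative \<open>'n \<times> m\<close> matrix with
  \<open>M = V V\<^sup>T\<close>.  As the number \<open>m\<close> of columns varies, \<open>V\<close> is a function of a row index in
  \<open>'n\<close> and a column index in \<open>{..<m}\<close>; its values at other column indices are irrelevant.
\<close>
definition nonneg_factor :: "real^'n^'n \<Rightarrow> nat \<Rightarrow> ('n \<Rightarrow> nat \<Rightarrow> real) \<Rightarrow> bool" where
  "nonneg_factor M m V \<longleftrightarrow>
     (\<forall>i. \<forall>l<m. 0 \<le> V i l) \<and> M = (\<chi> i j. \<Sum>l<m. V i l * V j l)"

definition completely_positive :: "(real^'n^'n) set" where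
  "completely_positive = {M. \<exists>m V. nonneg_factor M m V}"

text \<open>
  The infimum of the empty set is \<open>\<infinity>\<close>, the value for matrices that are not completely
  positive.  A factor with \<open>m = 0\<close> columns exists exactly for the zero matrix.
\<close>
definition cp_rank :: "real^'n^'n \<Rightarrow> enat" where
  "cp_rank M = (INF m \<in> {m. \<exists>V. nonneg_factor M m V}. enat m)"

text \<open>
  The maximal cp-rank \<open>p\<^sub>n\<close> for \<open>n = CARD('n)\<close>.  The supremum is finite and attained, see
  \<open>max_cp_rank_attained\<close> and \<open>max_cp_rank_finite\<close> below.
\<close>
definition max_cp_rank :: "'n::finite itself \<Rightarrow> enat" where
  "max_cp_rank _ = (SUP M \<in> (completely_positive :: (real^'n^'n) set). cp_rank M)"

definition cp_rank_class :: "nat \<Rightarrow> (real^'n^'n) set" where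
  "cp_rank_class k = {M \<in> completely_positive. cp_rank M = enat k}"

lemma cp_rank_le: "nonneg_factor M m V \<Longrightarrow> cp_rank M \<le> enat m"
  unfolding cp_rank_def by (rule INF_lower) auto

lemma cp_rank_attained:
  assumes "M \<in> completely_positive"
  obtains m V where "nonneg_factor M m V" "cp_rank M = enat m"
proof -
  let ?A = "enat ` {m. \<exists>V. nonneg_factor M m V}"
  have "?A \<noteq> {}"
    using assms by (auto simp: completely_positive_def)
  then have "Inf ?A \<in> ?A"
    unfolding Inf_enat_def using LeastI_ex[of "\<lambda>x. x \<in> ?A"] by auto
  then show ?thesis
    using that by (auto simp: cp_rank_def)
qed

lemma cp_rank_not_completely_positive:
  "M \<notin> completely_positive \<Longrightarrow> cp_rank M = \<infinity>"
  by (auto simp: cp_rank_def completely_positive_def top_enat_def)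

lemma zero_completely_positive: "0 \<in> completely_positive"
proof -
  have "nonneg_factor (0::real^'n^'n) 0 V" for V
    by (simp add: nonneg_factor_def vec_eq_iff)
  then show ?thesis
    unfolding completely_positive_def by blast
qed

lemma cp_rank_eq_0_iff: "cp_rank M = 0 \<longleftrightarrow> M = 0"
proof
  assume 0: "cp_rank M = 0"
  then have "M \<in> completely_positive"
    using cp_rank_not_completely_positive by fastforce
  with 0 obtain V where "nonneg_factor M 0 V"
    by (metis cp_rank_attained enat_0_iff(1))
  then show "M = 0"
    by (simp add: nonneg_factor_def vec_eq_iff)
next
  assume "M = 0"
  then have "nonneg_factor M 0 (\<lambda>_ _. 0)"
    by (simp add: nonneg_factor_def vec_eq_iff)
  then show "cp_rank M = 0"
    using cp_rank_le by (metis le_zero_eq zero_enat_def)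
qed

lemma cp_rank_le_dim:
  fixes M :: "real^'n^'n"
  assumes "M \<in> completely_positive"
  shows "cp_rank M \<le> enat (DIM(real^'n^'n) + 1)"
proof -
  define X where "X = {(\<chi> i j. v i * v j) :: real^'n^'n | v. \<forall>i. 0 \<le> v i}"
  obtain m V where V: "nonneg_factor M m V"
    using assms by (auto simp: completely_positive_def)
  show ?thesis
  proof (cases "m = 0")
    case True
    then show ?thesis
      using cp_rank_le[OF V] by (simp add: zero_enat_def[symmetric])
  next
    case False
    define P where "P l = ((\<chi> i j. V i l * V j l) :: real^'n^'n)" for l
    have "P l \<in> X" if "l < m" for l
      using V that by (auto simp: P_def X_def nonneg_factor_def intro!: exI[of _ "\<lambda>i. V i l"])
    then have "(\<Sum>l<m. (1 / real m) *\<^sub>R P l) \<in> convex hull X"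
      using False by (intro convex_sum) (auto intro: hull_inc)
    then obtain S u where S: "finite S" "S \<subseteq> X" "card S \<le> DIM(real^'n^'n) + 1"
      and u: "\<forall>x\<in>S. 0 \<le> u x" and eq: "(\<Sum>x\<in>S. u x *\<^sub>R x) = (\<Sum>l<m. (1 / real m) *\<^sub>R P l)"
      unfolding convex_hull_caratheodory by auto
    have "M = real m *\<^sub>R (\<Sum>l<m. (1 / real m) *\<^sub>R P l)"
      using V False by (simp add: P_def nonneg_factor_def vec_eq_iff scaleR_sum_right)
    then have M: "M = (\<Sum>x\<in>S. (real m * u x) *\<^sub>R x)"
      by (simp add: eq[symmetric] scaleR_sum_right)
    have "\<forall>x\<in>S. \<exists>v. (\<forall>i. 0 \<le> v i) \<and> x = (\<chi> i j. v i * v j)"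
      using S(2) unfolding X_def by blast
    then obtain w where w: "\<And>x. x \<in> S \<Longrightarrow> (\<forall>i. 0 \<le> w x i) \<and> x = (\<chi> i j. w x i * w x j)"
      by (auto dest!: bchoice)
    obtain f where f: "bij_betw f {..<card S} S"
      using ex_bij_betw_nat_finite[OF S(1)] by (auto simp: atLeast0LessThan)
    define W where "W i l = sqrt (real m * u (f l)) * w (f l) i" for i l
    have fS: "f l \<in> S" if "l < card S" for l
      using f that by (auto simp: bij_betw_def)
    have "M $ i $ j = (\<Sum>l<card S. W i l * W j l)" for i j
    proof -
      have "M $ i $ j = (\<Sum>x\<in>S. real m * u x * (x $ i $ j))"
        by (simp add: M)
      also have "\<dots> = (\<Sum>l<card S. real m * u (f l) * (f l $ i $ j))"
        by (rule sum.reindex_bij_betw[OF f, symmetric])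
      also have "\<dots> = (\<Sum>l<card S. W i l * W j l)"
      proof (rule sum.cong[OF refl])
        fix l assume "l \<in> {..<card S}"
        then have l: "f l \<in> S" using fS by auto
        have "f l $ i $ j = w (f l) i * w (f l) j"
          by (subst conjunct2[OF w[OF l]]) simp
        moreover have "W i l * W j l
            = (sqrt (real m * u (f l)) * sqrt (real m * u (f l))) * (w (f l) i * w (f l) j)"
          unfolding W_def by (simp only: ac_simps)
        moreover have "sqrt (real m * u (f l)) * sqrt (real m * u (f l)) = real m * u (f l)"
          using u l by simp
        ultimately show "real m * u (f l) * (f l $ i $ j) = W i l * W j l"
          by (simp only:)
      qed
      finally show ?thesis .
    qed
    moreover have "0 \<le> W i l" if "l < card S" for i l
      using u w fS[OF that] by (auto simp: W_def)
    ultimately have "nonneg_factor M (card S) W"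
      by (simp add: nonneg_factor_def vec_eq_iff)
    from cp_rank_le[OF this] S(3) show ?thesis
      by (meson enat_ord_simps(1) order_trans)
  qed
qed

lemma max_cp_rank_finite: "max_cp_rank TYPE('n::finite) \<noteq> \<infinity>"
proof -
  have "max_cp_rank TYPE('n) \<le> enat (DIM(real^'n^'n) + 1)"
    unfolding max_cp_rank_def by (rule SUP_least) (rule cp_rank_le_dim)
  then show ?thesis
    by (metis enat_ord_code(5) infinity_ileE)
qed

lemma max_cp_rank_attained:
  "\<exists>M \<in> (completely_positive :: (real^'n^'n) set). cp_rank M = max_cp_rank TYPE('n::finite)"
proof -
  let ?A = "cp_rank ` (completely_positive :: (real^'n^'n) set)"
  have "?A \<noteq> {}"
    using zero_completely_positive by blast
  moreover have "finite ?A"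
    by (rule finite_enat_bounded) (use cp_rank_le_dim in blast)
  ultimately have "Sup ?A \<in> ?A"
    by (simp add: Sup_enat_def)
  then show ?thesis
    by (auto simp: max_cp_rank_def)
qed

end

theory Submission
  imports Defs "HOL-Computational_Algebra.Polynomial"
begin

text \<open>
  Matrices of rank less than \<open>n\<close> have empty interior, hence \<open>n \<le> k\<close> is necessary.  Conversely,
  dropping columns from a minimal factor of a matrix of maximal cp-rank gives \<open>M = V V\<^sup>T\<close> of
  cp-rank exactly \<open>k\<close>.  The set \<open>cpr \<le> k - 1\<close> is closed, so nearby matrices have cp-rank at least
  \<open>k\<close> (possibly infinite).  Since \<open>V\<close> has \<open>k \<ge> n\<close> columns, its first \<open>n\<close> columns can be perturbed to
  an entrywise positive invertible matrix \<open>A\<close>; there \<open>X \<mapsto> X X\<^sup>T\<close> is a submersion onto the symmetric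
  matrices, so a whole neighbourhood of the perturbed product has cp-rank at most \<open>k\<close>.
\<close>

section \<open>Concatenating and splitting factors; subadditivity of the cp-rank\<close>

lemma sum_lessThan_add:
  fixes f :: "nat \<Rightarrow> 'a::comm_monoid_add"
  shows "(\<Sum>l<a + b. f l) = (\<Sum>l<a. f l) + (\<Sum>l<b. f (l + a))"
  by (induction b) (auto simp: add.commute add.left_commute)

lemma nonneg_factor_append:
  assumes "nonneg_factor A a V" "nonneg_factor B b W"
  shows "nonneg_factor (A + B) (a + b) (\<lambda>i l. if l < a then V i l else W i (l - a))"
proof -
  have sum_split: "(\<Sum>l<a + b. (if l < a then V i l else W i (l - a)) * (if l < a then V j l else W j (l - a)))
     = (\<Sum>l<a. V i l * V j l) + (\<Sum>l<b. W i l * W j l)" for i j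
    by (simp add: sum_lessThan_add)
  show ?thesis
    using assms by (auto simp: nonneg_factor_def vec_eq_iff sum_split)
qed

text \<open>A minimal factor can be padded with zero columns, so every number of columns from the
  cp-rank upwards occurs.\<close>

lemma cp_rank_le_iff: "cp_rank M \<le> enat m \<longleftrightarrow> (\<exists>V. nonneg_factor M m V)"
proof
  assume le: "cp_rank M \<le> enat m"
  then have "M \<in> completely_positive"
    using cp_rank_not_completely_positive by fastforce
  then obtain m' V where V: "nonneg_factor M m' V" "cp_rank M = enat m'"
    by (rule cp_rank_attained)
  have "nonneg_factor (0 :: real^'a^'a) (m - m') (\<lambda>_ _. 0)"
    by (simp add: nonneg_factor_def vec_eq_iff)
  from nonneg_factor_append[OF V(1) this] le V(2) show "\<exists>V. nonneg_factor M m V"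
    by auto
qed (auto intro: cp_rank_le)

lemma cp_rank_add_le:
  assumes "cp_rank A \<le> enat a" "cp_rank B \<le> enat b"
  shows "cp_rank (A + B) \<le> enat (a + b)"
  using assms nonneg_factor_append unfolding cp_rank_le_iff by blast

text \<open>Keep the first \<open>k\<close> columns of a minimal factor. If their product
  \<open>N\<close> needed fewer than \<open>k\<close> columns, adding back the remaining
  \<open>m - k\<close> would give a factor of \<open>M\<close> with fewer than \<open>m\<close>
  columns.\<close>

lemma ex_cp_rank_eq:
  fixes M :: "real^'n^'n"
  assumes "cp_rank M = enat m" "k \<le> m"
  shows "\<exists>N :: real^'n^'n. cp_rank N = enat k"
proof -
  obtain V where V: "nonneg_factor M m V"
    using assms(1) cp_rank_le_iff by (metis order_refl)
  define N where "N = ((\<chi> i j. \<Sum>l<k. V i l * V j l) :: real^'n^'n)"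
  define R where "R = ((\<chi> i j. \<Sum>l<m - k. V i (l + k) * V j (l + k)) :: real^'n^'n)"
  have "nonneg_factor N k V" "nonneg_factor R (m - k) (\<lambda>i l. V i (l + k))"
    using V assms(2) by (auto simp: nonneg_factor_def N_def R_def)
  then have N: "cp_rank N \<le> enat k" and R: "cp_rank R \<le> enat (m - k)"
    using cp_rank_le_iff by blast+
  have "(\<Sum>l<m. V i l * V j l) = (\<Sum>l<k. V i l * V j l) + (\<Sum>l<m - k. V i (l + k) * V j (l + k))" for i j
    using sum_lessThan_add[of "\<lambda>l. V i l * V j l" k "m - k"] assms(2) by simp
  then have "M = N + R"
    using V by (simp add: nonneg_factor_def N_def R_def vec_eq_iff)
  obtain k' where k': "cp_rank N = enat k'"
    using N by (cases "cp_rank N") auto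
  have "enat m \<le> enat (k' + (m - k))"
    using cp_rank_add_le[of N k' R "m - k"] k' R assms(1) \<open>M = N + R\<close> by simp
  with N k' assms(2) have "k' = k"
    by simp
  with k' show ?thesis by blast
qed

section \<open>Closedness of the sets of bounded cp-rank\<close>

text \<open>Adding one column maps the previous set times a box continuously onto the next set.
  Induction on the number of columns thus avoids a topology on the functions
  \<open>V\<close>.\<close>

lemma compact_bounded_factors:
  "compact {M :: real^'n^'n. \<exists>V. nonneg_factor M m V \<and> (\<forall>i. \<forall>l<m. V i l \<le> r)}"
proof (induction m)
  case 0
  have "{M :: real^'n^'n. \<exists>V. nonneg_factor M 0 V \<and> (\<forall>i. \<forall>l<0. V i l \<le> r)} = {0}"
    by (auto simp: nonneg_factor_def vec_eq_iff)
  then show ?case by simp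
next
  case (Suc m)
  let ?K = "{M :: real^'n^'n. \<exists>V. nonneg_factor M m V \<and> (\<forall>i. \<forall>l<m. V i l \<le> r)}"
  let ?f = "\<lambda>(A, v). A + ((\<chi> i j. v $ i * v $ j) :: real^'n^'n)"
  have "{M :: real^'n^'n. \<exists>V. nonneg_factor M (Suc m) V \<and> (\<forall>i. \<forall>l<Suc m. V i l \<le> r)}
      = ?f ` (?K \<times> cbox 0 (\<chi> i. r))" (is "?L = ?R")
  proof (intro equalityI subsetI)
    fix M assume "M \<in> ?L"
    then obtain V where V: "nonneg_factor M (Suc m) V" "\<forall>i. \<forall>l<Suc m. V i l \<le> r"
      by blast
    define A where "A = ((\<chi> i j. \<Sum>l<m. V i l * V j l) :: real^'n^'n)"
    define v where "v = ((\<chi> i. V i m) :: real^'n)"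
    have "nonneg_factor A m V"
      using V by (auto simp: nonneg_factor_def A_def)
    then have "A \<in> ?K"
      using V(2) less_Suc_eq by blast
    moreover have "v \<in> cbox 0 (\<chi> i. r)"
      using V by (auto simp: nonneg_factor_def mem_box_cart v_def)
    moreover have "M = ?f (A, v)"
      using V(1) by (simp add: nonneg_factor_def A_def v_def vec_eq_iff)
    ultimately show "M \<in> ?R" by blast
  next
    fix M assume "M \<in> ?R"
    then obtain A v V where M: "M = ?f (A, v)" and v: "v \<in> cbox 0 (\<chi> i. r)"
      and V: "nonneg_factor A m V" "\<forall>i. \<forall>l<m. V i l \<le> r"
      by blast
    define W where "W i l = (if l < m then V i l else v $ i)" for i l
    have "nonneg_factor M (Suc m) W"
      using V(1) v M by (auto simp: nonneg_factor_def W_def vec_eq_iff mem_box_cart)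
    moreover have "\<forall>i. \<forall>l<Suc m. W i l \<le> r"
      using V v by (auto simp: W_def mem_box_cart)
    ultimately show "M \<in> ?L" by blast
  qed
  moreover have "compact ?R"
    using Suc.IH unfolding case_prod_unfold
    by (intro compact_continuous_image compact_Times compact_cbox continuous_intros) auto
  ultimately show ?case by simp
qed

text \<open>The diagonal entries of \<open>M\<close> are sums of squares of entries of
  \<open>V\<close>, so a bound on \<open>M\<close> bounds every factor. A convergent sequence is
  bounded, hence lies in a single compact set of matrices with bounded factors, which also contains
  the limit.\<close>

lemma closed_cp_rank_le: "closed {M :: real^'n^'n. cp_rank M \<le> enat m}"
proof -
  let ?K = "\<lambda>r. {M :: real^'n^'n. \<exists>V. nonneg_factor M m V \<and> (\<forall>i. \<forall>l<m. V i l \<le> r)}"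
  have bound: "M \<in> ?K (1 + r)" if "cp_rank M \<le> enat m" "norm M \<le> r" for M r
  proof -
    obtain V where V: "nonneg_factor M m V"
      using \<open>cp_rank M \<le> enat m\<close> cp_rank_le_iff by blast
    have "V i l \<le> 1 + r" if "l < m" for i l
    proof -
      have "(V i l)\<^sup>2 \<le> (\<Sum>l<m. V i l * V i l)"
        unfolding power2_eq_square using that
        by (intro member_le_sum[where f = "\<lambda>l. V i l * V i l"]) auto
      also have "\<dots> = M $ i $ i"
        using V by (simp add: nonneg_factor_def)
      also have "\<dots> \<le> r"
        using component_le_norm_cart[of "M $ i" i] Finite_Cartesian_Product.norm_nth_le[of M i]
          \<open>norm M \<le> r\<close> by linarith
      finally have sq: "(V i l)\<^sup>2 \<le> r" .
      \<comment> \<open>This turns the bound \<open>r\<close> on the square into a bound on the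
        entry without a square root; the generous \<open>1 + r\<close> suffices because
        \<open>r\<close> is nonnegative.\<close>
      have "2 * V i l \<le> (V i l)\<^sup>2 + 1"
        using zero_le_power2[of "V i l - 1"] by (simp add: power2_eq_square algebra_simps)
      with sq zero_le_power2[of "V i l"] show ?thesis by linarith
    qed
    with V show ?thesis by blast
  qed
  show ?thesis
    unfolding closed_sequential_limits
  proof (intro allI impI, elim conjE)
    fix x and L :: "real^'n^'n"
    assume x: "\<forall>n. x n \<in> {M :: real^'n^'n. cp_rank M \<le> enat m}" and lim: "x \<longlonglongrightarrow> L"
    obtain r where r: "\<And>n. norm (x n) \<le> r"
      using convergent_imp_Bseq[of x] lim by (auto simp: convergent_def Bseq_def)
    then have "\<forall>n. x n \<in> ?K (1 + r)"
      using bound x by blast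
    then have "L \<in> ?K (1 + r)"
      using compact_imp_closed[OF compact_bounded_factors] lim
      unfolding closed_sequential_limits by blast
    then show "L \<in> {M. cp_rank M \<le> enat m}"
      using cp_rank_le_iff by blast
  qed
qed

section \<open>Small perturbations and invertibility\<close>

lemma ex_small_multiple:
  fixes a :: "'a::real_normed_vector"
  assumes "0 < e"
  shows "\<exists>d>0. d * norm a < e"
\<comment> \<open>The witness is \<open>e / (norm a + 1)\<close>; the added 1 covers
  \<open>a = 0\<close> and makes the inequality strict.\<close>
proof (intro exI conjI)
  have "0 < norm a + 1"
    by (simp add: add_nonneg_pos)
  with assms show "0 < e / (norm a + 1)" "e / (norm a + 1) * norm a < e"
    by (simp_all add: divide_simps)
qed

text \<open>The determinant of \<open>A + x *\<^sub>R mat 1\<close> is a nonzero polynomial in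
  \<open>x\<close>, so its finitely many roots cannot exhaust the interval from 0 to
  \<open>e\<close>.\<close>

lemma ex_small_invertible_shift:
  fixes A :: "real^'n^'n"
  assumes "0 < e"
  shows "\<exists>x. 0 < x \<and> x < e \<and> invertible (A + x *\<^sub>R mat 1)"
proof -
  \<comment> \<open>The Leibniz expansion of the determinant, with linear polynomials as
    entries.\<close>
  define p where "p = (\<Sum>q | q permutes (UNIV :: 'n set).
     [:of_int (sign q):] * (\<Prod>i\<in>UNIV. [:A $ i $ q i, if i = q i then 1 else 0:]))"
  have p: "poly p x = det (A + x *\<^sub>R mat 1)" for x
    unfolding p_def det_def poly_sum poly_mult poly_prod
    by (intro sum.cong prod.cong refl arg_cong2[where f = "(*)"]) (auto simp: mat_def)
  \<comment> \<open>Since \<open>y\<close> exceeds the operator norm of \<open>A\<close>,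
    \<open>-y\<close> is not an eigenvalue of \<open>A\<close>; hence \<open>p\<close> does not
    vanish at \<open>y\<close>.\<close>
  define y where "y = onorm ((*v) A) + 1"
  have "v = 0" if "(A + y *\<^sub>R mat 1) *v v = 0" for v
  proof -
    have "A *v v = - (y *\<^sub>R v)"
      using that by (simp add: matrix_vector_mult_add_rdistrib scaleR_matrix_vector_assoc[symmetric] eq_neg_iff_add_eq_0)
    then have "norm (A *v v) = \<bar>y\<bar> * norm v"
      by simp
    moreover have "norm (A *v v) \<le> onorm ((*v) A) * norm v"
      by (rule onorm) simp
    moreover have "\<bar>y\<bar> = y"
      using onorm_pos_le[of "(*v) A"] by (simp add: y_def)
    ultimately have "norm v \<le> 0"
      by (simp add: y_def algebra_simps)
    then show ?thesis by simp
  qed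
  then have "invertible (A + y *\<^sub>R mat 1)"
    unfolding invertible_left_inverse matrix_left_invertible_ker by blast
  then have "p \<noteq> 0"
    using p[of y] by (auto simp: invertible_det_nz)
  then have "finite {x. poly p x = 0}"
    by (rule poly_roots_finite)
  then have "infinite ({0<..<e} - {x. poly p x = 0})"
    using assms by (intro Diff_infinite_finite) auto
  then obtain x where "x \<in> {0<..<e} - {x. poly p x = 0}"
    using infinite_imp_nonempty by blast
  then show ?thesis
    using p by (auto simp: invertible_det_nz intro!: exI[of _ x])
qed

text \<open>Fewer than \<open>n\<close> columns span a proper subspace, and a nonzero vector
  orthogonal to all of them lies in the kernel of \<open>M\<close>.\<close>

lemma not_invertible_if_cp_rank_less:
  fixes M :: "real^'n^'n"
  assumes "cp_rank M \<le> enat k" "k < CARD('n)"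
  shows "\<not> invertible M"
proof -
  obtain V where V: "nonneg_factor M k V"
    using assms(1) cp_rank_le_iff by blast
  define S where "S = (\<lambda>l. (\<chi> i. V i l) :: real^'n) ` {..<k}"
  have "dim S < DIM(real^'n)"
    using dim_le_card'[of S] card_image_le[of "{..<k}" "\<lambda>l. (\<chi> i. V i l) :: real^'n"] assms(2)
    by (simp add: S_def)
  then obtain y where y: "y \<noteq> 0" "\<And>z. z \<in> span S \<Longrightarrow> orthogonal y z"
    by (rule orthogonal_to_subspace_exists) blast
  have orth: "(\<Sum>j\<in>UNIV. V j l * y $ j) = 0" if "l < k" for l
    using y(2)[OF span_base, of "\<chi> i. V i l"] that
    by (auto simp: S_def orthogonal_def inner_vec_def mult.commute)
  have "M *v y = 0"
  proof (rule vec_eq_iff[THEN iffD2], rule allI)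
    fix i
    have "(M *v y) $ i = (\<Sum>j\<in>UNIV. \<Sum>l<k. V i l * (V j l * y $ j))"
      using V by (simp add: nonneg_factor_def matrix_vector_mult_def sum_distrib_right mult.assoc)
    also have "\<dots> = (\<Sum>l<k. V i l * (\<Sum>j\<in>UNIV. V j l * y $ j))"
      by (subst sum.swap) (simp add: sum_distrib_left)
    also have "\<dots> = 0"
      using orth by simp
    finally show "(M *v y) $ i = 0 $ i" by simp
  qed
  with y(1) show ?thesis
    unfolding invertible_left_inverse matrix_left_invertible_ker by blast
qed

section \<open>Local surjectivity of the product with the transpose\<close>

lemma matrix_mult_transpose_nth: "(X ** transpose Y) $ i $ j = (\<Sum>l\<in>UNIV. X $ i $ l * Y $ j $ l)"
  by (simp add: matrix_matrix_mult_def transpose_def)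

lemma transpose_mult_transpose:
  fixes X Y :: "real^'n^'n"
  shows "transpose (X ** transpose Y) = Y ** transpose X"
  by (simp add: matrix_transpose_mul)

lemma cp_rank_mult_transpose_le:
  fixes X :: "real^'n^'n"
  assumes "\<And>i j. 0 \<le> X $ i $ j"
  shows "cp_rank (X ** transpose X) \<le> enat CARD('n)"
proof -
  \<comment> \<open>Factors number their columns by naturals, so the index type has to be
    enumerated.\<close>
  obtain h where h: "bij_betw h {..<CARD('n)} (UNIV :: 'n set)"
    using ex_bij_betw_nat_finite[of "UNIV :: 'n set"] by (auto simp: atLeast0LessThan)
  have "nonneg_factor (X ** transpose X) CARD('n) (\<lambda>i l. X $ i $ h l)"
    using assms
    by (simp add: nonneg_factor_def vec_eq_iff matrix_mult_transpose_nth
        sum.reindex_bij_betw[OF h, symmetric])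
  then show ?thesis by (rule cp_rank_le)
qed

lemma bounded_bilinear_mult_transpose:
  "bounded_bilinear (\<lambda>X Y :: real^'n^'n. X ** transpose Y)"
  unfolding bilinear_conv_bounded_bilinear[symmetric] bilinear_def linear_iff
  by (auto simp: vec_eq_iff matrix_mult_transpose_nth algebra_simps sum.distrib sum_distrib_left)

text \<open>By Sussmann's open mapping theorem, all matrices near
  \<open>A ** transpose A + C\<close> are values \<open>f X\<close> with \<open>X\<close> positive.
  A symmetric one equals \<open>X ** transpose X + C\<close>, where \<open>X\<close> supplies
  \<open>n\<close> columns and the fixed \<open>C\<close> at most \<open>b\<close>.\<close>

lemma ex_open_cp_rank_le:
  fixes A C :: "real^'n^'n"
  assumes inv: "invertible A" and pos: "\<And>i j. 0 < A $ i $ j" and C: "cp_rank C \<le> enat b"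
    and symC: "transpose C = C"
  shows "\<exists>U. open U \<and> A ** transpose A + C \<in> U \<and>
           (\<forall>M\<in>U. transpose M = M \<longrightarrow> cp_rank M \<le> enat (CARD('n) + b))"
proof -
  interpret B: bounded_bilinear "\<lambda>X Y :: real^'n^'n. X ** transpose Y"
    by (rule bounded_bilinear_mult_transpose)
  define T where "T = {X :: real^'n^'n. \<forall>i j. 0 < X $ i $ j}"
  \<comment> \<open>The skew-symmetric correction makes the derivative at \<open>A\<close> surjective onto all matrices, and
    it vanishes whenever \<open>f X\<close> is symmetric.\<close>
  define f where "f X = X ** transpose X + (A ** transpose X - X ** transpose A) + C" for X
  obtain A' where A': "A ** A' = mat 1"
    using inv unfolding invertible_def by blast
  have "open T"
    unfolding T_def Collect_all_eq by (intro open_INT finite ballI open_Collect_less continuous_intros)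
  have der: "(f has_derivative (\<lambda>H. 2 *\<^sub>R (A ** transpose H))) (at A)"
  proof -
    have "(f has_derivative (\<lambda>H. (A ** transpose H + H ** transpose A)
            + (A ** transpose H - H ** transpose A) + 0)) (at A)"
      unfolding f_def
      by (intro has_derivative_add has_derivative_diff has_derivative_const
          B.FDERIV[of "\<lambda>X. X" "\<lambda>X. X" A UNIV "\<lambda>X. X" "\<lambda>X. X"] has_derivative_ident
          bounded_linear_imp_has_derivative B.bounded_linear_left B.bounded_linear_right)
    moreover have "(A ** transpose H + H ** transpose A) + (A ** transpose H - H ** transpose A) + 0
        = 2 *\<^sub>R (A ** transpose H)" for H
      by (simp add: scaleR_2)
    ultimately show ?thesis by simp
  qed
  have "f A \<in> interior (f ` T)"
  proof (rule sussmann_open_mapping[OF \<open>open T\<close> _ _ der])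
    show "continuous_on T f"
      unfolding f_def by (intro continuous_intros B.continuous_on)
    show "A \<in> T" "A \<in> interior T"
      using pos interior_open[OF \<open>open T\<close>] by (auto simp: T_def)
    \<comment> \<open>A right inverse of the derivative, obtained by solving
      \<open>2 *\<^sub>R (A ** transpose K) = H\<close> for \<open>K\<close>.\<close>
    show "bounded_linear (\<lambda>H :: real^'n^'n. (1/2) *\<^sub>R (transpose (A' ** H)))"
      unfolding linear_conv_bounded_linear[symmetric] linear_iff
      by (auto simp: vec_eq_iff transpose_def matrix_matrix_mult_def algebra_simps sum.distrib
          sum_distrib_left)
    have "2 *\<^sub>R (A ** transpose ((1/2) *\<^sub>R transpose (A' ** H))) = H" for H :: "real^'n^'n"
      using A' by (simp add: B.scaleR_right matrix_mul_assoc del: transpose_scalar)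
    then show "(\<lambda>H. 2 *\<^sub>R (A ** transpose H)) \<circ> (\<lambda>H :: real^'n^'n. (1/2) *\<^sub>R (transpose (A' ** H))) = id"
      by auto
  qed simp
  moreover have "f A = A ** transpose A + C"
    by (simp add: f_def)
  moreover have "cp_rank M \<le> enat (CARD('n) + b)" if "M \<in> interior (f ` T)" "transpose M = M" for M
  proof -
    have "M \<in> f ` T"
      using that(1) interior_subset by blast
    then obtain X where X: "X \<in> T" "M = f X"
      by blast
    define D where "D = A ** transpose X - X ** transpose A"
    have MD: "M = X ** transpose X + D + C"
      by (simp add: X(2) f_def D_def)
    have transpose_add: "transpose (Y + Z) = transpose Y + transpose Z" for Y Z :: "real^'n^'n"
      by (simp add: vec_eq_iff transpose_def)
    \<comment> \<open>Transposing \<open>M\<close> only flips the sign of the skew part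
      \<open>D\<close>, so symmetry of \<open>M\<close> forces \<open>D = 0\<close>.\<close>
    have "transpose D = - D"
      by (simp add: D_def vec_eq_iff transpose_def matrix_matrix_mult_def mult.commute)
    then have "transpose M = X ** transpose X - D + C"
      unfolding MD transpose_add transpose_mult_transpose symC by simp
    with that(2) MD have "D + D = 0"
      by (simp add: algebra_simps)
    then have "D = 0"
      by (simp add: scaleR_2[symmetric])
    with MD have "M = X ** transpose X + C"
      by simp
    moreover have "cp_rank (X ** transpose X) \<le> enat CARD('n)"
      using X(1) by (intro cp_rank_mult_transpose_le less_imp_le) (simp add: T_def)
    ultimately show ?thesis
      using cp_rank_add_le C by blast
  qed
  ultimately show ?thesis
    by (intro exI[of _ "interior (f ` T)"]) auto
qed

section \<open>Perturbing a factor and locating interior points\<close>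

lemma nonneg_factor_symmetric: "nonneg_factor M m V \<Longrightarrow> transpose M = M"
  by (simp add: nonneg_factor_def vec_eq_iff transpose_def mult.commute)

text \<open>The first \<open>n\<close> columns of a factor form a square matrix \<open>A\<close>,
  the others contribute \<open>C\<close>. A small change of \<open>A\<close> alone makes it positive
  and invertible while the product stays in \<open>G\<close>.\<close>

lemma ex_open_cp_rank_le_near:
  fixes M :: "real^'n^'n"
  assumes M: "cp_rank M \<le> enat k" and k: "CARD('n) \<le> k" and G: "open G" "M \<in> G"
  shows "\<exists>U N. open U \<and> N \<in> U \<and> N \<in> G \<and> transpose N = N \<and>
           (\<forall>M\<in>U. transpose M = M \<longrightarrow> cp_rank M \<le> enat k)"
proof -
  obtain V where V: "nonneg_factor M k V"
    using M cp_rank_le_iff by blast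
  obtain h where h: "bij_betw h (UNIV :: 'n set) {..<CARD('n)}"
    using ex_bij_betw_finite_nat[of "UNIV :: 'n set"] by (auto simp: atLeast0LessThan)
  define b where "b = k - CARD('n)"
  define A where "A = ((\<chi> i j. V i (h j)) :: real^'n^'n)"
  define C where "C = ((\<chi> i j. \<Sum>l<b. V i (l + CARD('n)) * V j (l + CARD('n))) :: real^'n^'n)"
  have hl: "h j < k" for j
    using bij_betw_apply[OF h, of j] k by simp
  have A0: "0 \<le> A $ i $ j" for i j
    using V hl by (simp add: A_def nonneg_factor_def)
  have C: "nonneg_factor C b (\<lambda>i l. V i (l + CARD('n)))"
    using V k by (auto simp: nonneg_factor_def C_def b_def)
  have "(\<Sum>l<k. V i l * V j l) = (\<Sum>l\<in>UNIV. V i (h l) * V j (h l)) + C $ i $ j" for i j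
    using sum_lessThan_add[of "\<lambda>l. V i l * V j l" "CARD('n)" b] k
    by (simp add: C_def b_def sum.reindex_bij_betw[OF h, of "\<lambda>l. V i l * V j l"])
  then have MAC: "M = A ** transpose A + C"
    using V by (simp add: nonneg_factor_def A_def vec_eq_iff matrix_mult_transpose_nth)
  \<comment> \<open>A positive multiple of the all-ones matrix makes every entry positive; the later
    shift by a positive multiple of the identity gives invertibility and preserves
    positivity.\<close>
  define J where "J = ((\<chi> i j. 1) :: real^'n^'n)"
  define g where "g X = X ** transpose X + C" for X :: "real^'n^'n"
  interpret B: bounded_bilinear "\<lambda>X Y :: real^'n^'n. X ** transpose Y"
    by (rule bounded_bilinear_mult_transpose)
  have "open (g -` G)"
    unfolding g_def by (intro open_vimage G continuous_intros B.continuous_on)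
  moreover have "A \<in> g -` G"
    using G(2) MAC by (simp add: g_def)
  ultimately obtain e where e: "0 < e" "\<And>X. dist X A < e \<Longrightarrow> X \<in> g -` G"
    unfolding open_dist by blast
  obtain s where s: "0 < s" "s * norm J < e / 2"
    using ex_small_multiple[of "e / 2" J] e(1) by auto
  obtain d where d: "0 < d" "d * norm (mat 1 :: real^'n^'n) < e / 2"
    using ex_small_multiple[of "e / 2" "mat 1 :: real^'n^'n"] e(1) by auto
  obtain x where x: "0 < x" "x < d" "invertible ((A + s *\<^sub>R J) + x *\<^sub>R mat 1)"
    using ex_small_invertible_shift[OF d(1)] by blast
  define X where "X = (A + s *\<^sub>R J) + x *\<^sub>R mat 1"
  have "dist X A \<le> norm (s *\<^sub>R J) + norm (x *\<^sub>R (mat 1 :: real^'n^'n))"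
    unfolding X_def dist_norm using norm_triangle_ineq[of "s *\<^sub>R J" "x *\<^sub>R mat 1"] by simp
  also have "\<dots> \<le> s * norm J + d * norm (mat 1 :: real^'n^'n)"
    using s x by (simp add: mult_right_mono)
  also have "\<dots> < e"
    using s d by linarith
  finally have "g X \<in> G"
    using e(2) by blast
  have pos: "0 < X $ i $ j" for i j
    using A0[of i j] s(1) x(1) by (simp add: X_def J_def mat_def add_nonneg_pos add_pos_nonneg)
  have "transpose (g X) = g X"
    using nonneg_factor_symmetric[OF C]
    by (simp add: g_def vec_eq_iff transpose_def matrix_matrix_mult_def mult.commute)
  moreover have "cp_rank C \<le> enat b"
    using C by (rule cp_rank_le)
  then obtain U where "open U" "g X \<in> U"
    "\<forall>M\<in>U. transpose M = M \<longrightarrow> cp_rank M \<le> enat (CARD('n) + b)"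
    using ex_open_cp_rank_le[of X C b] x(3) pos nonneg_factor_symmetric[OF C]
    unfolding g_def X_def by blast
  ultimately show ?thesis
    using \<open>g X \<in> G\<close> k unfolding b_def by (intro exI[of _ U] exI[of _ "g X"]) simp
qed

theorem theorem4p1:
  fixes k :: nat
  assumes "k \<ge> 1"
  shows "top_of_set {M :: real^'n^'n. transpose M = M} interior_of cp_rank_class k \<noteq> {}
    \<longleftrightarrow> CARD('n) \<le> k \<and> enat k \<le> max_cp_rank TYPE('n)"
proof
  assume "top_of_set {M :: real^'n^'n. transpose M = M} interior_of cp_rank_class k \<noteq> {}"
  then obtain G and M :: "real^'n^'n" where G: "open G" "M \<in> G" and M: "transpose M = M"
    and sub: "\<And>N. transpose N = N \<Longrightarrow> N \<in> G \<Longrightarrow> N \<in> cp_rank_class k"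
    unfolding interior_of_def openin_open by blast
  have "enat k \<le> max_cp_rank TYPE('n)"
    using sub[OF M G(2)] unfolding max_cp_rank_def cp_rank_class_def
    by (auto intro: SUP_upper2)
  moreover have "CARD('n) \<le> k"
  proof (rule ccontr)
    assume k: "\<not> CARD('n) \<le> k"
    \<comment> \<open>For \<open>k\<close> below \<open>n\<close> the class contains only singular
      matrices, yet a small multiple of the identity moves \<open>M\<close> to an invertible
      symmetric matrix inside \<open>G\<close>.\<close>
    obtain e where e: "0 < e" "\<And>N. dist N M < e \<Longrightarrow> N \<in> G"
      using G unfolding open_dist by blast
    obtain d where d: "0 < d" "d * norm (mat 1 :: real^'n^'n) < e"
      using ex_small_multiple[OF e(1)] by blast
    obtain x where x: "0 < x" "x < d" "invertible (M + x *\<^sub>R mat 1)"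
      using ex_small_invertible_shift[OF d(1)] by blast
    have "x * norm (mat 1 :: real^'n^'n) \<le> d * norm (mat 1 :: real^'n^'n)"
      using x by (intro mult_right_mono) auto
    then have "dist (M + x *\<^sub>R mat 1) M < e"
      using x(1) d(2) by (simp add: dist_norm)
    moreover have "transpose (M + x *\<^sub>R mat 1) = M + x *\<^sub>R mat 1"
      using M by (simp add: vec_eq_iff transpose_def mat_def)
    ultimately have "cp_rank (M + x *\<^sub>R mat 1) \<le> enat k"
      using e(2) sub unfolding cp_rank_class_def by auto
    with k x(3) not_invertible_if_cp_rank_less show False
      by (metis not_le)
  qed
  ultimately show "CARD('n) \<le> k \<and> enat k \<le> max_cp_rank TYPE('n)" by simp
next
  assume k: "CARD('n) \<le> k \<and> enat k \<le> max_cp_rank TYPE('n)"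
  obtain L :: "real^'n^'n" where L: "cp_rank L = max_cp_rank TYPE('n)"
    using max_cp_rank_attained by blast
  obtain p where "max_cp_rank TYPE('n) = enat p"
    using max_cp_rank_finite by blast
  with L k ex_cp_rank_eq[of L p k] obtain M :: "real^'n^'n" where M: "cp_rank M = enat k"
    by auto
  \<comment> \<open>As \<open>k \<ge> 1\<close>, \<open>k - 1\<close> is a true predecessor:
    \<open>M\<close> lies in \<open>G\<close>, and for members of \<open>G\<close> the bound
    \<open>cp_rank P \<le> enat k\<close> becomes an equality.\<close>
  define G where "G = - {M :: real^'n^'n. cp_rank M \<le> enat (k - 1)}"
  have "open G" "M \<in> G"
    using closed_cp_rank_le assms M by (auto simp: G_def)
  then obtain U and N :: "real^'n^'n" where U: "open U" "N \<in> U" "N \<in> G" "transpose N = N"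
    "\<And>M. M \<in> U \<Longrightarrow> transpose M = M \<Longrightarrow> cp_rank M \<le> enat k"
    using ex_open_cp_rank_le_near[of M k G] k M by auto
  have "P \<in> cp_rank_class k" if "P \<in> U" "P \<in> G" "transpose P = P" for P
  proof -
    have le: "cp_rank P \<le> enat k"
      using U(5) that by blast
    then have "P \<in> completely_positive"
      using cp_rank_not_completely_positive by fastforce
    moreover have "cp_rank P = enat k"
      using le that(2) by (cases "cp_rank P") (auto simp: G_def)
    ultimately show ?thesis
      by (simp add: cp_rank_class_def)
  qed
  then have "{M. transpose M = M} \<inter> (U \<inter> G)
      \<subseteq> top_of_set {M. transpose M = M} interior_of cp_rank_class k"
    using U(1) \<open>open G\<close> by (intro interior_of_maximal openin_open_Int) auto
  then show "top_of_set {M :: real^'n^'n. transpose M = M} interior_of cp_rank_class k \<noteq> {}"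
    using U(2-4) by blast
qed

end
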